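(* Let $K$ be a field with $\mathrm{char}(K)=0$. The quadratic algebra $\mathcal{A}_2$ generated over $K$ by $x,y,z$ with relations $$yx=xy+axz+bz^2,\qquad zx=xz,\qquad zy=yz+cz^2,$$ where $a,b,c\in K-\{0\}$ and $ac<0$, has trivial center, i.e. $Z(\mathcal{A}_2)=K$.
   Context: The algebra is the quotient of the free associative $K$-algebra on $x,y,z$ by the stated relations; it is a skew $PBW$ extension of the commutative polynomial ring $K[x,z]$ in the variable $y$. $Z(\mathcal{A}_2)$ denotes the center of $\mathcal{A}_2$. *)

theory Defs
  imports
    "HOL-Library.Poly_Mapping"
    "HOL-Algebra.QuotRing"
    "HOL-Algebra.Subrings"
    "HOL-Algebra.Algebraic_Closure_Type"
begin

section \<open>The free associative algebra on x, y, z\<close>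

datatype gen = GenX | GenY | GenZ

text \<open>
  Words form the free monoid under concatenation. It is written additively because
  the convolution product of \<^typ>\<open>'w \<Rightarrow>\<^sub>0 'k\<close> is defined over the class \<^class>\<open>monoid_add\<close>;
  no commutativity is involved.
\<close>

datatype word = Word (letters: "gen list")

instantiation word :: monoid_add
begin

definition zero_word :: word where "0 = Word []"

definition plus_word :: "word \<Rightarrow> word \<Rightarrow> word" where
  "u + v = Word (letters u @ letters v)"

instance
  by standard (simp_all add: zero_word_def plus_word_def)

end

text \<open>
  The free associative unital algebra is the monoid algebra of the word monoid:
  finitely supported functions from words to the field, with convolution.
\<close>

type_synonym 'k free_alg = "word \<Rightarrow>\<^sub>0 'k"

definition scalar :: "'k::field \<Rightarrow> 'k free_alg" where
  "scalar k = Poly_Mapping.single 0 k"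

definition gen :: "gen \<Rightarrow> 'k::field free_alg" where
  "gen g = Poly_Mapping.single (Word [g]) 1"


section \<open>The quadratic algebra and its center\<close>

definition relators :: "'k::field \<Rightarrow> 'k \<Rightarrow> 'k \<Rightarrow> 'k free_alg set" where
  "relators a b c =
    (let x = gen GenX; y = gen GenY; z = gen GenZ in
      {y * x - (x * y + scalar a * x * z + scalar b * z ^ 2),
       z * x - x * z,
       z * y - (y * z + scalar c * z ^ 2)})"

text \<open>
  In HOL-Algebra \<^const>\<open>genideal\<close> is the two-sided ideal generated by a set. It is
  automatically stable under scalars, since these are elements of the free algebra.
\<close>

definition rel_ideal :: "'k::field \<Rightarrow> 'k \<Rightarrow> 'k \<Rightarrow> 'k free_alg set" where
  "rel_ideal a b c = genideal ring_of_type_algebra (relators a b c)"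

definition A2 :: "'k::field \<Rightarrow> 'k \<Rightarrow> 'k \<Rightarrow> 'k free_alg set ring" where
  "A2 a b c = ring_of_type_algebra Quot rel_ideal a b c"

definition A2_scalar :: "'k::field \<Rightarrow> 'k \<Rightarrow> 'k \<Rightarrow> 'k \<Rightarrow> 'k free_alg set" where
  "A2_scalar a b c k = rel_ideal a b c +>\<^bsub>ring_of_type_algebra\<^esub> scalar k"

definition ring_center :: "('r, 'm) ring_scheme \<Rightarrow> 'r set" where
  "ring_center R = {u \<in> carrier R. \<forall>v \<in> carrier R. u \<otimes>\<^bsub>R\<^esub> v = v \<otimes>\<^bsub>R\<^esub> u}"


section \<open>Ordered subfields\<close>

text \<open>
  An inequality between elements of an arbitrary field of characteristic 0 refers to an
  ordering. Here \<open>lt\<close> is a strict total field ordering of the subfield \<open>F\<close>; its values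
  outside \<open>F\<close> are irrelevant. An ordered field is the case \<open>F = UNIV\<close>; real elements of
  the complex field are the case where \<open>F\<close> is the set of real numbers.
\<close>

definition ordered_subfield :: "'k::field set \<Rightarrow> ('k \<Rightarrow> 'k \<Rightarrow> bool) \<Rightarrow> bool" where
  "ordered_subfield F lt \<longleftrightarrow>
     subfield F ring_of_type_algebra \<and>
     (\<forall>u\<in>F. \<not> lt u u) \<and>
     (\<forall>u\<in>F. \<forall>v\<in>F. \<forall>w\<in>F. lt u v \<longrightarrow> lt v w \<longrightarrow> lt u w) \<and>
     (\<forall>u\<in>F. \<forall>v\<in>F. u \<noteq> v \<longrightarrow> lt u v \<or> lt v u) \<and>
     (\<forall>u\<in>F. \<forall>v\<in>F. \<forall>w\<in>F. lt u v \<longrightarrow> lt (u + w) (v + w)) \<and>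
     (\<forall>u\<in>F. \<forall>v\<in>F. lt 0 u \<longrightarrow> lt 0 v \<longrightarrow> lt 0 (u * v))"

end

theory Submission
  imports Defs
begin

text \<open>
  The algebra is the Ore extension \<open>K[x,z][y; \<delta>]\<close> for the derivation with
  \<open>\<delta> x = a x z + b z\<^sup>2\<close> and \<open>\<delta> z = - c z\<^sup>2\<close>. The monomials \<open>x\<^sup>i z\<^sup>j y\<^sup>k\<close> span it by rewriting
  modulo the relations, and acting on \<open>1\<close> in the left regular representation shows that
  the coefficients are unique. If \<open>p = \<Sum>k. f\<^sub>k y\<^sup>k\<close> is central, commuting with \<open>y\<close> gives
  \<open>\<delta> f\<^sub>k = 0\<close>. On the polynomials of each degree, \<open>\<delta>\<close> is triangular with diagonal entries
  \<open>a i - c j\<close>, which vanish only for \<open>i = j = 0\<close> because \<open>a c < 0\<close>; so every \<open>f\<^sub>k\<close> is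
  constant. Commuting with \<open>z\<close> and comparing the terms free of \<open>y\<close> gives
  \<open>f\<^sub>k (- c)\<^sup>k k! = 0\<close> for \<open>k > 0\<close>, so \<open>p\<close> is a scalar.
\<close>

section \<open>The left regular representation\<close>

text \<open>
  \<open>f i j k\<close> is the coefficient of \<open>x\<^sup>i z\<^sup>j y\<^sup>k\<close>. Finite support is not required, as each
  coefficient of the result of an operator depends on finitely many coefficients of \<open>f\<close>.
\<close>

type_synonym 'k coeffs = "nat \<Rightarrow> nat \<Rightarrow> nat \<Rightarrow> 'k"

fun shift_x :: "'k::zero coeffs \<Rightarrow> 'k coeffs" where
  "shift_x f 0 j k = 0"
| "shift_x f (Suc i) j k = f i j k"

fun shift_z :: "'k::zero coeffs \<Rightarrow> 'k coeffs" where
  "shift_z f i 0 k = 0"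
| "shift_z f i (Suc j) k = f i j k"

fun shift_y :: "'k::zero coeffs \<Rightarrow> 'k coeffs" where
  "shift_y f i j 0 = 0"
| "shift_y f i j (Suc k) = f i j k"

text \<open>The derivation sends \<open>x^i z^j\<close> to
  \<open>(a i - c j) x^i z^(j+1) + b i x^(i-1) z^(j+2)\<close>. Read at a target index, this gives
  one contribution from \<open>(i, j-1)\<close> and one from \<open>(i+1, j-2)\<close>; the clauses
  for small \<open>j\<close> drop sources with a negative exponent.\<close>

fun deriv_xz :: "'k::field \<Rightarrow> 'k \<Rightarrow> 'k \<Rightarrow> 'k coeffs \<Rightarrow> 'k coeffs" where
  "deriv_xz a b c f i 0 k = 0"
| "deriv_xz a b c f i (Suc 0) k = a * of_nat i * f i 0 k"
| "deriv_xz a b c f i (Suc (Suc j)) k =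
     (a * of_nat i - c * of_nat (Suc j)) * f i (Suc j) k + b * of_nat (Suc i) * f (Suc i) j k"

text \<open>The Ore rule \<open>y f = f y + \<delta> f\<close>, applied to each coefficient
  \<open>f\<close> of a power of \<open>y\<close>.\<close>

definition mult_y :: "'k::field \<Rightarrow> 'k \<Rightarrow> 'k \<Rightarrow> 'k coeffs \<Rightarrow> 'k coeffs" where
  "mult_y a b c f = (\<lambda>i j k. shift_y f i j k + deriv_xz a b c f i j k)"

fun gen_op :: "'k::field \<Rightarrow> 'k \<Rightarrow> 'k \<Rightarrow> gen \<Rightarrow> 'k coeffs \<Rightarrow> 'k coeffs" where
  "gen_op a b c GenX = shift_x"
| "gen_op a b c GenY = mult_y a b c"
| "gen_op a b c GenZ = shift_z"

definition word_op :: "'k::field \<Rightarrow> 'k \<Rightarrow> 'k \<Rightarrow> word \<Rightarrow> 'k coeffs \<Rightarrow> 'k coeffs" where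
  "word_op a b c w = foldr (gen_op a b c) (letters w)"

definition rep :: "'k::field \<Rightarrow> 'k \<Rightarrow> 'k \<Rightarrow> 'k free_alg \<Rightarrow> 'k coeffs \<Rightarrow> 'k coeffs" where
  "rep a b c p f = (\<lambda>i j k. \<Sum>w\<in>Poly_Mapping.keys p.
     Poly_Mapping.lookup p w * word_op a b c w f i j k)"

section \<open>Linearity and multiplicativity of the representation\<close>

lemma gen_op_add:
  "gen_op a b c g (\<lambda>i j k. f i j k + h i j k) =
   (\<lambda>i j k. gen_op a b c g f i j k + gen_op a b c g h i j k)"
proof (intro ext)
  fix i j k
  show "gen_op a b c g (\<lambda>i j k. f i j k + h i j k) i j k =
        gen_op a b c g f i j k + gen_op a b c g h i j k"
    by (cases g; cases i; cases k; cases "(a, b, c, f, i, j, k)" rule: deriv_xz.cases)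
      (auto simp: mult_y_def algebra_simps)
qed

lemma gen_op_scale:
  "gen_op a b c g (\<lambda>i j k. r * f i j k) = (\<lambda>i j k. r * gen_op a b c g f i j k)"
proof (intro ext)
  fix i j k
  show "gen_op a b c g (\<lambda>i j k. r * f i j k) i j k = r * gen_op a b c g f i j k"
    by (cases g; cases i; cases k; cases "(a, b, c, f, i, j, k)" rule: deriv_xz.cases)
      (auto simp: mult_y_def algebra_simps)
qed

lemma word_op_add:
  "word_op a b c w (\<lambda>i j k. f i j k + h i j k) =
   (\<lambda>i j k. word_op a b c w f i j k + word_op a b c w h i j k)"
proof -
  have "foldr (gen_op a b c) l (\<lambda>i j k. f i j k + h i j k) =
    (\<lambda>i j k. foldr (gen_op a b c) l f i j k + foldr (gen_op a b c) l h i j k)" for l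
    by (induction l) (simp_all add: gen_op_add)
  then show ?thesis
    by (simp add: word_op_def)
qed

lemma word_op_scale:
  "word_op a b c w (\<lambda>i j k. r * f i j k) = (\<lambda>i j k. r * word_op a b c w f i j k)"
proof -
  have "foldr (gen_op a b c) l (\<lambda>i j k. r * f i j k) =
    (\<lambda>i j k. r * foldr (gen_op a b c) l f i j k)" for l
    by (induction l) (simp_all add: gen_op_scale)
  then show ?thesis
    by (simp add: word_op_def)
qed

lemma word_op_plus: "word_op a b c (u + w) f = word_op a b c u (word_op a b c w f)"
  by (simp add: word_op_def plus_word_def)

text \<open>Updating a key outside the support is the same as adding a single. Additive claims about
  the free algebra, and later about normal forms, thus reduce to one term.\<close>

lemma poly_mapping_single_induct [case_names zero single add]:
  fixes p :: "'w \<Rightarrow>\<^sub>0 'k::comm_monoid_add"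
  assumes "P 0" and "\<And>w r. P (Poly_Mapping.single w r)"
    and "\<And>p q. P p \<Longrightarrow> P q \<Longrightarrow> P (p + q)"
  shows "P p"
proof (induction p rule: update_induct)
  case const
  show ?case by fact
next
  case (update f w r)
  then have "Poly_Mapping.update w r f = f + Poly_Mapping.single w r"
    by (intro poly_mapping_eqI)
      (auto simp: lookup_update lookup_add lookup_single in_keys_iff when_def)
  with update assms show ?case by simp
qed

lemma rep_zero [simp]: "rep a b c 0 f = (\<lambda>i j k. 0)"
  by (simp add: rep_def)

lemma rep_single [simp]:
  "rep a b c (Poly_Mapping.single w r) f = (\<lambda>i j k. r * word_op a b c w f i j k)"
  by (simp add: rep_def fun_eq_iff)

lemma rep_add: "rep a b c (p + q) f = (\<lambda>i j k. rep a b c p f i j k + rep a b c q f i j k)"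
  unfolding rep_def fun_eq_iff by (auto intro!: setsum_keys_plus_distrib simp: algebra_simps)

lemma rep_add_arg:
  "rep a b c p (\<lambda>i j k. f i j k + h i j k) = (\<lambda>i j k. rep a b c p f i j k + rep a b c p h i j k)"
  by (simp add: rep_def word_op_add algebra_simps sum.distrib)

lemma rep_scale_arg: "rep a b c p (\<lambda>i j k. r * f i j k) = (\<lambda>i j k. r * rep a b c p f i j k)"
  by (simp add: rep_def word_op_scale sum_distrib_left mult.left_commute)

lemma rep_diff: "rep a b c (p - q) f = (\<lambda>i j k. rep a b c p f i j k - rep a b c q f i j k)"
  using rep_add[of a b c "p - q" q f] by (simp add: fun_eq_iff)

lemma rep_mult: "rep a b c (p * q) f = rep a b c p (rep a b c q f)"
proof (induction p rule: poly_mapping_single_induct)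
  case (single u r)
  show ?case
    \<comment> \<open>The instance \<open>r = 0\<close> of \<open>word_op_scale\<close> says that
      word operators kill the zero family, which settles \<open>q = 0\<close>.\<close>
    by (induction q rule: poly_mapping_single_induct)
      (simp_all add: rep_add rep_add_arg mult_single word_op_plus word_op_scale word_op_add
        distrib_left mult.assoc fun_eq_iff
        word_op_scale[where r = 0 and f = "\<lambda>i j k. 0", simplified])
qed (simp_all add: rep_add distrib_right)

lemma rep_one [simp]: "rep a b c 1 f = f"
  by (simp flip: single_one add: word_op_def zero_word_def)

lemma rep_scalar [simp]: "rep a b c (scalar r) f = (\<lambda>i j k. r * f i j k)"
  by (simp add: scalar_def word_op_def zero_word_def)

lemma rep_gen [simp]: "rep a b c (gen g) f = gen_op a b c g f"
  by (simp add: gen_def word_op_def)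

lemma rep_power: "rep a b c (p ^ n) f = (rep a b c p ^^ n) f"
  by (induction n) (simp_all add: rep_mult)

text \<open>Leibniz rule \<open>\<delta> (x f) = x \<delta> f + (\<delta> x) f\<close>, which is the
  relation for \<open>y x\<close> as an identity of operators.\<close>

lemma mult_y_shift_x:
  "mult_y a b c (shift_x f) =
   (\<lambda>i j k. shift_x (mult_y a b c f) i j k + a * shift_x (shift_z f) i j k
     + b * shift_z (shift_z f) i j k)"
proof (intro ext)
  fix i j k
  show "mult_y a b c (shift_x f) i j k = shift_x (mult_y a b c f) i j k
    + a * shift_x (shift_z f) i j k + b * shift_z (shift_z f) i j k"
    by (cases i; cases k; cases "(a, b, c, f, i, j, k)" rule: deriv_xz.cases)
      (auto simp: mult_y_def algebra_simps)
qed

lemma shift_z_shift_x: "shift_z (shift_x f) = shift_x (shift_z f)"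
proof (intro ext)
  show "shift_z (shift_x f) i j k = shift_x (shift_z f) i j k" for i j k
    by (cases i; cases j) auto
qed

text \<open>Leibniz rule for multiplication by \<open>z\<close>, with
  \<open>\<delta> z = - c z^2\<close> moved to the other side.\<close>

lemma shift_z_mult_y:
  "shift_z (mult_y a b c f) =
   (\<lambda>i j k. mult_y a b c (shift_z f) i j k + c * shift_z (shift_z f) i j k)"
proof (intro ext)
  fix i j k
  show "shift_z (mult_y a b c f) i j k =
    mult_y a b c (shift_z f) i j k + c * shift_z (shift_z f) i j k"
  \<comment> \<open>Three layers of \<open>j\<close> matter: \<open>shift_z\<close> consumes one,
    and \<open>deriv_xz\<close> distinguishes two more.\<close>
  proof (cases j)
    case (Suc j')
    then show ?thesis
      by (cases k; cases "(a, b, c, f, i, j', k)" rule: deriv_xz.cases)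
        (auto simp: mult_y_def algebra_simps)
  qed (cases k; simp add: mult_y_def)
qed

lemma rep_relators: "p \<in> relators a b c \<Longrightarrow> rep a b c p f = (\<lambda>i j k. 0)"
  unfolding relators_def Let_def
  by (elim insertE emptyE)
    (simp_all add: rep_diff rep_add rep_mult power2_eq_square
      mult_y_shift_x shift_z_shift_x shift_z_mult_y)

section \<open>Congruence modulo the relations\<close>

lemma ring_free_alg: "ring (ring_of_type_algebra :: 'k::field free_alg ring)"
proof -
  have "\<exists>y. x + y = 0" for x :: "'k free_alg"
    by (rule exI[of _ "- x"]) simp
  then show ?thesis
    unfolding ring_of_type_algebra_def
    by unfold_locales (auto simp: algebra_simps Units_def)
qed

lemma ring_of_type_algebra_simps [simp]:
  "carrier ring_of_type_algebra = UNIV"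
  "x \<otimes>\<^bsub>ring_of_type_algebra\<^esub> y = x * y"
  "x \<oplus>\<^bsub>ring_of_type_algebra\<^esub> y = x + y"
  "\<one>\<^bsub>ring_of_type_algebra\<^esub> = 1"
  "\<zero>\<^bsub>ring_of_type_algebra\<^esub> = 0"
  by (simp_all add: ring_of_type_algebra_def)

lemma ideal_rel_ideal: "ideal (rel_ideal a b c) ring_of_type_algebra"
  unfolding rel_ideal_def by (rule ring.genideal_ideal[OF ring_free_alg]) simp

lemma relators_subset: "relators a b c \<subseteq> rel_ideal a b c"
  unfolding rel_ideal_def by (rule ring.genideal_self[OF ring_free_alg]) simp

lemma rel_ideal_add: "p \<in> rel_ideal a b c \<Longrightarrow> q \<in> rel_ideal a b c \<Longrightarrow> p + q \<in> rel_ideal a b c"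
  using additive_subgroup.a_closed[OF ideal.axioms(1)[OF ideal_rel_ideal]] by fastforce

lemma rel_ideal_zero: "0 \<in> rel_ideal a b c"
  using additive_subgroup.zero_closed[OF ideal.axioms(1)[OF ideal_rel_ideal]] by fastforce

lemma rel_ideal_mult_left: "p \<in> rel_ideal a b c \<Longrightarrow> q * p \<in> rel_ideal a b c"
  using ideal.I_l_closed[OF ideal_rel_ideal] by fastforce

lemma rel_ideal_mult_right: "p \<in> rel_ideal a b c \<Longrightarrow> p * q \<in> rel_ideal a b c"
  using ideal.I_r_closed[OF ideal_rel_ideal] by fastforce

lemma rel_ideal_uminus: "p \<in> rel_ideal a b c \<Longrightarrow> - p \<in> rel_ideal a b c"
  using rel_ideal_mult_left[of p a b c "- 1"] by simp

text \<open>The annihilator of the representation is a two-sided ideal containing the relators,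
  hence contains the ideal they generate.\<close>

lemma rep_rel_ideal:
  assumes "p \<in> rel_ideal a b c"
  shows "rep a b c p f = (\<lambda>i j k. 0)"
proof -
  \<comment> \<open>Quantifying over all \<open>f\<close> makes right multiples immediate:
    \<open>p * q\<close> acts as \<open>p\<close> on another family.\<close>
  let ?N = "{p. \<forall>f. rep a b c p f = (\<lambda>i j k. 0)}"
  have "subgroup ?N (add_monoid ring_of_type_algebra)"
  proof (rule group.subgroupI)
    show "group (add_monoid (ring_of_type_algebra :: 'a free_alg ring))"
      by (rule abelian_group.a_group[OF ring.is_abelian_group[OF ring_free_alg]])
    show "inv\<^bsub>add_monoid ring_of_type_algebra\<^esub> p \<in> ?N" if "p \<in> ?N" for p
    proof -
      have "inv\<^bsub>add_monoid ring_of_type_algebra\<^esub> p = - p"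
        by (rule group.inv_equality[OF abelian_group.a_group[OF ring.is_abelian_group[OF ring_free_alg]]])
          simp_all
      then show ?thesis
        using that rep_diff[of a b c 0 p] by simp
    qed
  qed (auto simp: rep_add intro: exI[of _ 0])
  \<comment> \<open>Needed for left multiples, where an operator is applied to the zero
    family.\<close>
  moreover have "rep a b c p (\<lambda>i j k. 0) = (\<lambda>i j k. 0)" for p
    using rep_scale_arg[of a b c p 0 "\<lambda>i j k. 0"] by simp
  ultimately have "ideal ?N ring_of_type_algebra"
    by (intro idealI ring_free_alg) (simp_all add: rep_mult)
  then have "rel_ideal a b c \<subseteq> ?N"
    unfolding rel_ideal_def
    by (rule ring.genideal_minimal[OF ring_free_alg]) (auto simp: rep_relators)
  with assms show ?thesis by auto
qed

definition cong_rel :: "'k::field \<Rightarrow> 'k \<Rightarrow> 'k \<Rightarrow> 'k free_alg \<Rightarrow> 'k free_alg \<Rightarrow> bool" where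
  "cong_rel a b c p q \<longleftrightarrow> p - q \<in> rel_ideal a b c"

lemma cong_rel_refl [simp]: "cong_rel a b c p p"
  by (simp add: cong_rel_def rel_ideal_zero)

lemma cong_rel_sym: "cong_rel a b c p q \<Longrightarrow> cong_rel a b c q p"
  unfolding cong_rel_def using rel_ideal_uminus by fastforce

lemma cong_rel_trans [trans]:
  "cong_rel a b c p q \<Longrightarrow> cong_rel a b c q r \<Longrightarrow> cong_rel a b c p r"
  unfolding cong_rel_def using rel_ideal_add by fastforce

lemma cong_rel_add:
  "cong_rel a b c p p' \<Longrightarrow> cong_rel a b c q q' \<Longrightarrow> cong_rel a b c (p + q) (p' + q')"
  unfolding cong_rel_def using rel_ideal_add[of "p - p'" a b c "q - q'"] by (simp add: algebra_simps)

lemma cong_rel_diff: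
  "cong_rel a b c p p' \<Longrightarrow> cong_rel a b c q q' \<Longrightarrow> cong_rel a b c (p - q) (p' - q')"
  unfolding cong_rel_def using rel_ideal_add[of "p - p'" a b c "- (q - q')"] rel_ideal_uminus[of "q - q'" a b c]
  by (simp add: algebra_simps)

lemma cong_rel_mult:
  assumes "cong_rel a b c p p'" "cong_rel a b c q q'"
  shows "cong_rel a b c (p * q) (p' * q')"
proof -
  have "p * q - p' * q' = (p - p') * q + p' * (q - q')"
    by (simp add: algebra_simps)
  with assms show ?thesis
    unfolding cong_rel_def by (metis rel_ideal_add rel_ideal_mult_left rel_ideal_mult_right)
qed

text \<open>The representation factors through the quotient; this turns congruences into equations
  between coefficients.\<close>

lemma cong_rel_rep: "cong_rel a b c p q \<Longrightarrow> rep a b c p f = rep a b c q f"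
  using rep_rel_ideal[of "p - q" a b c f] by (simp add: cong_rel_def rep_diff fun_eq_iff)

section \<open>Scalars in the free algebra\<close>

lemma scalar_commute: "scalar r * p = p * scalar r"
  by (induction p rule: poly_mapping_single_induct)
    (simp_all add: scalar_def mult_single distrib_left distrib_right mult.commute)

lemma scalar_commute_left: "p * (scalar r * q) = scalar r * (p * q)"
  by (metis mult.assoc scalar_commute)

lemma scalar_add: "scalar (r + s) = scalar r + scalar s"
  by (simp add: scalar_def single_add)

lemma scalar_diff: "scalar (r - s) = scalar r - scalar s"
  by (simp add: scalar_def single_diff)

lemma scalar_mult: "scalar r * scalar s = scalar (r * s)"
  by (simp add: scalar_def mult_single)

lemma scalar_0 [simp]: "scalar 0 = 0"
  by (simp add: scalar_def)

lemma scalar_1 [simp]: "scalar 1 = 1"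
  by (simp add: scalar_def)

section \<open>Commutation rules for powers of the generators\<close>

lemma cong_zx: "cong_rel a b c (gen GenZ * gen GenX) (gen GenX * gen GenZ)"
  using relators_subset[of a b c] by (auto simp: relators_def cong_rel_def Let_def)

lemma cong_yx:
  "cong_rel a b c (gen GenY * gen GenX)
    (gen GenX * gen GenY + scalar a * gen GenX * gen GenZ + scalar b * gen GenZ ^ 2)"
  using relators_subset[of a b c] by (auto simp: relators_def cong_rel_def Let_def)

lemma cong_yz:
  "cong_rel a b c (gen GenY * gen GenZ) (gen GenZ * gen GenY - scalar c * gen GenZ ^ 2)"
proof -
  have "gen GenZ * gen GenY - (gen GenY * gen GenZ + scalar c * gen GenZ ^ 2) \<in> rel_ideal a b c"
    using relators_subset[of a b c] by (auto simp: relators_def Let_def)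
  from rel_ideal_uminus[OF this] show ?thesis
    by (simp add: cong_rel_def algebra_simps)
qed

lemma cong_z_x_power: "cong_rel a b c (gen GenZ * gen GenX ^ l) (gen GenX ^ l * gen GenZ)"
proof (induction l)
  case (Suc l)
  have "cong_rel a b c (gen GenZ * gen GenX * gen GenX ^ l) (gen GenX * gen GenZ * gen GenX ^ l)"
    by (intro cong_rel_mult cong_zx cong_rel_refl)
  also have "cong_rel a b c (gen GenX * gen GenZ * gen GenX ^ l) (gen GenX * (gen GenX ^ l * gen GenZ))"
    unfolding mult.assoc by (intro cong_rel_mult Suc.IH cong_rel_refl)
  finally show ?case
    by (simp add: mult.assoc)
qed simp

text \<open>The correction term is \<open>\<delta> (z^m) = - c m z^(m+1)\<close>.\<close>

lemma cong_y_z_power: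
  "cong_rel a b c (gen GenY * gen GenZ ^ m)
    (gen GenZ ^ m * gen GenY - scalar (c * of_nat m) * gen GenZ ^ Suc m)"
proof (induction m)
  case (Suc m)
  have "cong_rel a b c (gen GenY * gen GenZ * gen GenZ ^ m)
    ((gen GenZ * gen GenY - scalar c * gen GenZ ^ 2) * gen GenZ ^ m)"
    by (intro cong_rel_mult cong_yz cong_rel_refl)
  also have "(gen GenZ * gen GenY - scalar c * gen GenZ ^ 2) * gen GenZ ^ m =
    gen GenZ * (gen GenY * gen GenZ ^ m) - scalar c * gen GenZ ^ Suc (Suc m)"
    by (simp add: algebra_simps power2_eq_square)
  also have "cong_rel a b c \<dots> (gen GenZ *
    (gen GenZ ^ m * gen GenY - scalar (c * of_nat m) * gen GenZ ^ Suc m)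
    - scalar c * gen GenZ ^ Suc (Suc m))"
    by (intro cong_rel_diff cong_rel_mult Suc.IH cong_rel_refl)
  also have "gen GenZ *
    (gen GenZ ^ m * gen GenY - scalar (c * of_nat m) * gen GenZ ^ Suc m)
    - scalar c * gen GenZ ^ Suc (Suc m) =
    gen GenZ ^ Suc m * gen GenY - scalar (c * of_nat (Suc m)) * gen GenZ ^ Suc (Suc m)"
    by (simp add: right_diff_distrib mult.assoc scalar_commute_left distrib_left distrib_right scalar_add)
  finally show ?case
    by (simp add: mult.assoc)
qed simp

text \<open>The correction terms form \<open>\<delta> (x^l)\<close>. For \<open>l = 0\<close> the
  truncated exponent \<open>l - 1\<close> is harmless, as its coefficient is zero.\<close>

lemma cong_y_x_power:
  "cong_rel a b c (gen GenY * gen GenX ^ l)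
    (gen GenX ^ l * gen GenY + scalar (a * of_nat l) * (gen GenX ^ l * gen GenZ)
      + scalar (b * of_nat l) * (gen GenX ^ (l - 1) * gen GenZ ^ 2))"
proof (induction l)
  case (Suc l)
  let ?x = "gen GenX" and ?y = "gen GenY" and ?z = "gen GenZ"
  have zz: "cong_rel a b c (?z * (?z * ?x ^ l)) (?x ^ l * (?z * ?z))"
  proof -
    have "cong_rel a b c (?z * (?z * ?x ^ l)) (?z * (?x ^ l * ?z))"
      by (intro cong_rel_mult cong_z_x_power cong_rel_refl)
    also have "?z * (?x ^ l * ?z) = (?z * ?x ^ l) * ?z"
      by (simp add: mult.assoc)
    also have "cong_rel a b c \<dots> (?x ^ l * ?z * ?z)"
      by (intro cong_rel_mult cong_z_x_power cong_rel_refl)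
    finally show ?thesis
      by (simp add: mult.assoc)
  qed
  \<comment> \<open>The powers of \<open>x\<close> agree for \<open>l > 0\<close>; for
    \<open>l = 0\<close> both sides vanish through the scalar.\<close>
  have l: "scalar (b * of_nat l) * (?x * (?x ^ (l - Suc 0) * (?z * ?z))) =
    scalar (b * of_nat l) * (?x ^ l * (?z * ?z))"
    by (cases l) (simp_all add: mult.assoc)
  have "cong_rel a b c (?y * ?x * ?x ^ l)
    ((?x * ?y + scalar a * ?x * ?z + scalar b * ?z ^ 2) * ?x ^ l)"
    by (intro cong_rel_mult cong_yx cong_rel_refl)
  also have "(?x * ?y + scalar a * ?x * ?z + scalar b * ?z ^ 2) * ?x ^ l =
    ?x * (?y * ?x ^ l) + scalar a * (?x * (?z * ?x ^ l)) + scalar b * (?z * (?z * ?x ^ l))"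
    by (simp add: distrib_right mult.assoc power2_eq_square)
  also have "cong_rel a b c \<dots> (?x * (?x ^ l * ?y + scalar (a * of_nat l) * (?x ^ l * ?z)
      + scalar (b * of_nat l) * (?x ^ (l - 1) * ?z ^ 2))
    + scalar a * (?x * (?x ^ l * ?z)) + scalar b * (?x ^ l * (?z * ?z)))"
    by (intro cong_rel_add cong_rel_mult Suc.IH cong_z_x_power zz cong_rel_refl)
  also have "\<dots> = ?x ^ Suc l * ?y + scalar (a * of_nat (Suc l)) * (?x ^ Suc l * ?z)
      + scalar (b * of_nat (Suc l)) * (?x ^ (Suc l - 1) * ?z ^ 2)"
    by (simp add: mult.assoc scalar_commute_left distrib_left distrib_right scalar_add l
        power2_eq_square)
  finally show ?case
    by (simp add: mult.assoc)
qed simp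

section \<open>Normal forms\<close>

definition pbw_monom :: "nat \<times> nat \<times> nat \<Rightarrow> 'k::field free_alg" where
  "pbw_monom = (\<lambda>(l, m, n). gen GenX ^ l * gen GenZ ^ m * gen GenY ^ n)"

definition pbw :: "(nat \<times> nat \<times> nat \<Rightarrow>\<^sub>0 'k) \<Rightarrow> 'k::field free_alg" where
  "pbw v = (\<Sum>s\<in>Poly_Mapping.keys v. scalar (Poly_Mapping.lookup v s) * pbw_monom s)"

lemma pbw_zero [simp]: "pbw 0 = 0"
  by (simp add: pbw_def)

lemma pbw_single: "pbw (Poly_Mapping.single s r) = scalar r * pbw_monom s"
  by (simp add: pbw_def)

lemma pbw_add: "pbw (v + w) = pbw v + pbw w"
  unfolding pbw_def by (rule setsum_keys_plus_distrib) (simp_all add: scalar_add distrib_right)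

text \<open>The Ore rule on a basis monomial: \<open>y\<close> first passes \<open>x^l\<close>, then
  \<open>z^m\<close>, and the two multiples of \<open>x^l z^(m+1) y^n\<close> combine into the
  diagonal entry \<open>a l - c m\<close>.\<close>

lemma cong_y_pbw_monom:
  "cong_rel a b c (gen GenY * pbw_monom (l, m, n))
    (pbw_monom (l, m, Suc n) + scalar (a * of_nat l - c * of_nat m) * pbw_monom (l, Suc m, n)
      + scalar (b * of_nat l) * pbw_monom (l - 1, Suc (Suc m), n))"
proof -
  let ?x = "gen GenX" and ?y = "gen GenY" and ?z = "gen GenZ"
  have "?y * pbw_monom (l, m, n) = ?y * ?x ^ l * (?z ^ m * ?y ^ n)"
    by (simp add: pbw_monom_def mult.assoc)
  also have "cong_rel a b c \<dots> ((?x ^ l * ?y + scalar (a * of_nat l) * (?x ^ l * ?z)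
      + scalar (b * of_nat l) * (?x ^ (l - 1) * ?z ^ 2)) * (?z ^ m * ?y ^ n))"
    by (intro cong_rel_mult cong_y_x_power cong_rel_refl)
  also have "\<dots> = ?x ^ l * (?y * ?z ^ m) * ?y ^ n + scalar (a * of_nat l) * pbw_monom (l, Suc m, n)
      + scalar (b * of_nat l) * pbw_monom (l - 1, Suc (Suc m), n)"
    by (simp add: pbw_monom_def distrib_right mult.assoc power2_eq_square)
  also have "cong_rel a b c \<dots>
    (?x ^ l * (?z ^ m * ?y - scalar (c * of_nat m) * ?z ^ Suc m) * ?y ^ n
      + scalar (a * of_nat l) * pbw_monom (l, Suc m, n)
      + scalar (b * of_nat l) * pbw_monom (l - 1, Suc (Suc m), n))"
    by (intro cong_rel_add cong_rel_mult cong_y_z_power cong_rel_refl)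
  also have "\<dots> = pbw_monom (l, m, Suc n)
      + scalar (a * of_nat l - c * of_nat m) * pbw_monom (l, Suc m, n)
      + scalar (b * of_nat l) * pbw_monom (l - 1, Suc (Suc m), n)"
    by (simp add: pbw_monom_def left_diff_distrib right_diff_distrib mult.assoc
        scalar_commute_left scalar_diff)
  finally show ?thesis .
qed

lemma cong_gen_pbw_monom: "\<exists>v. cong_rel a b c (gen g * pbw_monom s) (pbw v)"
proof -
  obtain l m n where s: "s = (l, m, n)"
    by (cases s) auto
  show ?thesis
  proof (cases g)
    case GenX
    then have "gen g * pbw_monom s = pbw (Poly_Mapping.single (Suc l, m, n) 1)"
      by (simp add: s pbw_single pbw_monom_def mult.assoc)
    then show ?thesis
      by (metis cong_rel_refl)
  next
    case GenY
    then show ?thesis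
      using cong_y_pbw_monom[of a b c l m n]
      by (intro exI[of _ "Poly_Mapping.single (l, m, Suc n) 1
          + Poly_Mapping.single (l, Suc m, n) (a * of_nat l - c * of_nat m)
          + Poly_Mapping.single (l - 1, Suc (Suc m), n) (b * of_nat l)"])
        (simp add: s pbw_single pbw_add)
  next
    case GenZ
    have "cong_rel a b c (gen GenZ * gen GenX ^ l * (gen GenZ ^ m * gen GenY ^ n))
      (gen GenX ^ l * gen GenZ * (gen GenZ ^ m * gen GenY ^ n))"
      by (intro cong_rel_mult cong_z_x_power cong_rel_refl)
    with GenZ show ?thesis
      by (intro exI[of _ "Poly_Mapping.single (l, Suc m, n) 1"])
        (simp add: s pbw_single pbw_monom_def mult.assoc)
  qed
qed

lemma scalar_mult_pbw: "\<exists>w. scalar r * pbw v = pbw w"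
proof (induction v rule: poly_mapping_single_induct)
  case (single s q)
  have "scalar r * pbw (Poly_Mapping.single s q) = pbw (Poly_Mapping.single s (r * q))"
    by (simp add: pbw_single scalar_mult flip: mult.assoc)
  then show ?case by blast
next
  case (add v w)
  then show ?case
    by (metis distrib_left pbw_add)
qed (metis mult_zero_right pbw_zero)

lemma cong_gen_pbw: "\<exists>w. cong_rel a b c (gen g * pbw v) (pbw w)"
proof (induction v rule: poly_mapping_single_induct)
  case zero
  show ?case
    by (metis cong_rel_refl mult_zero_right pbw_zero)
next
  case (single s r)
  obtain w where "cong_rel a b c (gen g * pbw_monom s) (pbw w)"
    using cong_gen_pbw_monom by blast
  then have "cong_rel a b c (scalar r * (gen g * pbw_monom s)) (scalar r * pbw w)"
    by (intro cong_rel_mult cong_rel_refl)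
  then show ?case
    using scalar_mult_pbw[of r w] by (auto simp: pbw_single scalar_commute_left)
next
  case (add v w)
  then show ?case
    by (metis cong_rel_add distrib_left pbw_add)
qed

text \<open>Spanning: a word is built from the right, and each letter prepended to a normal form can
  be rewritten into one.\<close>

lemma cong_pbw: "\<exists>v. cong_rel a b c p (pbw v)"
proof (induction p rule: poly_mapping_single_induct)
  case zero
  show ?case
    by (metis cong_rel_refl pbw_zero)
next
  case (single w r)
  have word: "\<exists>v. cong_rel a b c (Poly_Mapping.single (Word gs) 1) (pbw v)" for gs
  proof (induction gs)
    case Nil
    have "Poly_Mapping.single (Word []) 1 = pbw (Poly_Mapping.single (0, 0, 0) 1)"
      by (simp add: pbw_single pbw_monom_def flip: zero_word_def)
    then show ?case
      by (metis cong_rel_refl)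
  next
    case (Cons g gs)
    then obtain v where v: "cong_rel a b c (Poly_Mapping.single (Word gs) 1) (pbw v)"
      by blast
    have "Poly_Mapping.single (Word (g # gs)) 1 = gen g * Poly_Mapping.single (Word gs) 1"
      by (simp add: gen_def mult_single plus_word_def)
    with v show ?case
      by (metis cong_gen_pbw cong_rel_mult cong_rel_refl cong_rel_trans)
  qed
  obtain v where "cong_rel a b c (Poly_Mapping.single w 1) (pbw v)"
    using word[of "letters w"] by auto
  then have "cong_rel a b c (scalar r * Poly_Mapping.single w 1) (scalar r * pbw v)"
    by (intro cong_rel_mult cong_rel_refl)
  moreover have "scalar r * Poly_Mapping.single w 1 = Poly_Mapping.single w r"
    by (simp add: scalar_def mult_single)
  ultimately show ?case
    using scalar_mult_pbw[of r v] by auto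
next
  case (add p q)
  then show ?case
    by (metis cong_rel_add pbw_add)
qed

section \<open>Action on basis monomials and uniqueness of coefficients\<close>

definition monom_coeffs :: "nat \<Rightarrow> nat \<Rightarrow> nat \<Rightarrow> 'k::field coeffs" where
  "monom_coeffs l m n = (\<lambda>i j k. if i = l \<and> j = m \<and> k = n then 1 else 0)"

lemma rep_pbw:
  "rep a b c (pbw v) f i j k =
   (\<Sum>s\<in>Poly_Mapping.keys v. Poly_Mapping.lookup v s * rep a b c (pbw_monom s) f i j k)"
proof (induction v rule: poly_mapping_single_induct)
  case (add v w)
  have "(\<Sum>s\<in>Poly_Mapping.keys (v + w).
      Poly_Mapping.lookup (v + w) s * rep a b c (pbw_monom s) f i j k) =
    (\<Sum>s\<in>Poly_Mapping.keys v. Poly_Mapping.lookup v s * rep a b c (pbw_monom s) f i j k) +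
    (\<Sum>s\<in>Poly_Mapping.keys w. Poly_Mapping.lookup w s * rep a b c (pbw_monom s) f i j k)"
    by (rule setsum_keys_plus_distrib) (simp_all add: distrib_right)
  with add show ?case
    by (simp add: pbw_add rep_add)
qed (simp_all add: pbw_single rep_mult)

lemma rep_pbw_monom:
  "rep a b c (pbw_monom (l, m, n)) f =
   (shift_x ^^ l) ((shift_z ^^ m) ((mult_y a b c ^^ n) f))"
proof -
  have "rep a b c (gen g) = gen_op a b c g" for g
    by (rule ext) simp
  then show ?thesis
    by (simp add: pbw_monom_def rep_mult rep_power)
qed

lemma shift_x_monom: "shift_x (monom_coeffs l m n) = monom_coeffs (Suc l) m n"
proof (intro ext)
  show "shift_x (monom_coeffs l m n) i j k = monom_coeffs (Suc l) m n i j k" for i j k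
    by (cases i) (auto simp: monom_coeffs_def)
qed

lemma shift_z_monom: "shift_z (monom_coeffs l m n) = monom_coeffs l (Suc m) n"
proof (intro ext)
  show "shift_z (monom_coeffs l m n) i j k = monom_coeffs l (Suc m) n i j k" for i j k
    by (cases j) (auto simp: monom_coeffs_def)
qed

text \<open>Powers of \<open>y\<close> have constant coefficient 1, which the derivation
  kills.\<close>

lemma mult_y_monom: "mult_y a b c (monom_coeffs 0 0 n) = monom_coeffs 0 0 (Suc n)"
proof (intro ext)
  show "mult_y a b c (monom_coeffs 0 0 n) i j k = monom_coeffs 0 0 (Suc n) i j k" for i j k
    by (cases k; cases "(a, b, c, monom_coeffs 0 0 n :: 'a coeffs, i, j, k)" rule: deriv_xz.cases)
      (auto simp: monom_coeffs_def mult_y_def split: if_splits)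
qed

lemma shift_x_power_monom: "(shift_x ^^ l) (monom_coeffs 0 m n) = monom_coeffs l m n"
  by (induction l) (simp_all add: shift_x_monom)

lemma shift_z_power_monom: "(shift_z ^^ m) (monom_coeffs l 0 n) = monom_coeffs l m n"
  by (induction m) (simp_all add: shift_z_monom)

lemma mult_y_power_monom:
  "(mult_y a b c ^^ n) (monom_coeffs 0 0 n') = monom_coeffs 0 0 (n + n')"
  by (induction n) (simp_all add: mult_y_monom)

lemma rep_pbw_monom_y_power:
  "rep a b c (pbw_monom (l, m, n)) (monom_coeffs 0 0 n') = monom_coeffs l m (n + n')"
  by (simp add: rep_pbw_monom mult_y_power_monom shift_z_power_monom shift_x_power_monom)

text \<open>Normal forms stay normal when multiplied by a power of \<open>y\<close> on the right.
  With \<open>n' = 0\<close> this recovers the coefficients of \<open>v\<close>; with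
  \<open>n' = 1\<close> it describes right multiplication by \<open>y\<close>.\<close>

lemma rep_pbw_y_power:
  "rep a b c (pbw v) (monom_coeffs 0 0 n') i j k =
   (if n' \<le> k then Poly_Mapping.lookup v (i, j, k - n') else 0)"
proof -
  have monom: "rep a b c (pbw_monom s) (monom_coeffs 0 0 n') i j k =
    (if s = (i, j, k - n') \<and> n' \<le> k then 1 else 0)" for s
    by (cases s, simp only: rep_pbw_monom_y_power) (auto simp: monom_coeffs_def)
  have "rep a b c (pbw v) (monom_coeffs 0 0 n') i j k =
    (\<Sum>s\<in>Poly_Mapping.keys v. if s = (i, j, k - n') \<and> n' \<le> k then Poly_Mapping.lookup v s else 0)"
    unfolding rep_pbw monom by (intro sum.cong refl) simp
  also have "\<dots> = (if n' \<le> k then Poly_Mapping.lookup v (i, j, k - n') else 0)"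
    by (cases "n' \<le> k") (simp_all add: in_keys_iff)
  finally show ?thesis .
qed

text \<open>The part of \<open>y\<^sup>n z\<close> free of \<open>y\<close> is \<open>\<delta>\<^sup>n z\<close>.\<close>

lemma mult_y_power_z:
  "(mult_y a b c ^^ n) (monom_coeffs 0 (Suc 0) 0) i j 0 =
   (if i = 0 \<and> j = Suc n then (- c) ^ n * fact n else 0)"
proof (induction n arbitrary: i j)
  case 0
  show ?case
    by (simp add: monom_coeffs_def)
next
  case (Suc n)
  let ?f = "(mult_y a b c ^^ n) (monom_coeffs 0 (Suc 0) 0)"
  \<comment> \<open>At exponent 0 of \<open>y\<close> the summand \<open>shift_y\<close> vanishes,
    so only the derivation contributes.\<close>
  have "(mult_y a b c ^^ Suc n) (monom_coeffs 0 (Suc 0) 0) i j 0 = deriv_xz a b c ?f i j 0"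
    by (simp add: mult_y_def)
  also have "\<dots> = (if i = 0 \<and> j = Suc (Suc n) then (- c) ^ Suc n * fact (Suc n) else 0)"
    by (cases "(a, b, c, ?f, i, j, 0 :: nat)" rule: deriv_xz.cases)
      (auto simp: Suc algebra_simps)
  finally show ?case .
qed

lemma shift_x_power_eq_0: "i < l \<Longrightarrow> (shift_x ^^ l) f i j k = 0"
proof (induction l arbitrary: i)
  case (Suc l)
  then show ?case by (cases i) auto
qed simp

lemma shift_z_power_apply:
  "(shift_z ^^ m) f i j k = (if m \<le> j then f i (j - m) k else 0)"
proof (induction m arbitrary: j)
  case (Suc m)
  then show ?case by (cases j) auto
qed simp

text \<open>The part of \<open>x^l z^m y^n z\<close> free of \<open>y\<close> is
  \<open>x^l z^m \<delta>^n z = (- c)^n n! x^l z^(m+n+1)\<close>; here its coefficient at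
  \<open>z^(j+1)\<close> is read off.\<close>

lemma rep_pbw_monom_z:
  "rep a b c (pbw_monom (l, m, n)) (monom_coeffs 0 (Suc 0) 0) 0 (Suc j) 0 =
   (if l = 0 \<and> m + n = j then (- c) ^ n * fact n else 0)"
proof (cases "l = 0")
  case True
  then show ?thesis
    by (auto simp: rep_pbw_monom shift_z_power_apply mult_y_power_z)
next
  case False
  then show ?thesis
    by (simp add: rep_pbw_monom shift_x_power_eq_0)
qed

section \<open>The center\<close>

text \<open>In the equation at \<open>z\<close>-exponent \<open>j + 1\<close>, the entry
  \<open>(i, j)\<close> carries the nonzero factor \<open>a i - c j\<close>, and the other entry has
  a smaller \<open>j\<close>. Induction on \<open>j\<close> with \<open>i\<close> free thus works
  without finite support.\<close>

lemma deriv_kernel: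
  assumes eigen: "\<And>i j :: nat. a * of_nat i = c * of_nat j \<Longrightarrow> i = 0 \<and> j = 0"
    and deriv: "\<And>i j. deriv_xz a b c f i j k = 0"
    and "(i, j) \<noteq> (0, 0)"
  shows "f i j k = 0"
  using \<open>(i, j) \<noteq> (0, 0)\<close>
proof (induction j arbitrary: i)
  case 0
  then show ?case
    using deriv[of i 1] eigen[of i 0] by auto
next
  case (Suc j)
  \<comment> \<open>The induction hypothesis applies because \<open>(Suc i, j)\<close> is never
    \<open>(0, 0)\<close>.\<close>
  have "f (Suc i) j k = 0"
    using Suc.IH by simp
  then show ?case
    using deriv[of i "Suc (Suc j)"] eigen[of i "Suc j"] by auto
qed

lemma central_cong_scalar:
  fixes a b c :: "'k::field_char_0"
  assumes "c \<noteq> 0"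
    and eigen: "\<And>i j :: nat. a * of_nat i = c * of_nat j \<Longrightarrow> i = 0 \<and> j = 0"
    and y: "cong_rel a b c (p * gen GenY) (gen GenY * p)"
    and z: "cong_rel a b c (p * gen GenZ) (gen GenZ * p)"
  shows "\<exists>r. cong_rel a b c p (scalar r)"
proof -
  obtain v where v: "cong_rel a b c p (pbw v)"
    using cong_pbw by blast
  let ?V = "\<lambda>i j k. Poly_Mapping.lookup v (i, j, k)"
  have rep_one_eq: "rep a b c p (monom_coeffs 0 0 0) = ?V"
    by (simp add: cong_rel_rep[OF v] rep_pbw_y_power fun_eq_iff)
  \<comment> \<open>Apply \<open>p y = y p\<close> to \<open>1\<close>: the left side is
    \<open>p\<close> acting on \<open>y\<close>, which the normal form shows to be a mere shift.
    Comparing leaves only the derivation.\<close>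
  have "rep a b c p (monom_coeffs 0 0 (Suc 0)) = mult_y a b c ?V"
    using cong_rel_rep[OF y, of "monom_coeffs 0 0 0"] by (simp add: rep_mult rep_one_eq mult_y_monom)
  moreover have "rep a b c p (monom_coeffs 0 0 (Suc 0)) i j k = shift_y ?V i j k" for i j k
    by (cases k) (simp_all add: cong_rel_rep[OF v] rep_pbw_y_power)
  ultimately have "deriv_xz a b c ?V i j k = 0" for i j k
    by (auto simp: mult_y_def fun_eq_iff)
  from deriv_kernel[OF eigen this]
  have off_y: "?V i j k = 0" if "(i, j) \<noteq> (0, 0)" for i j k
    using that by blast
  have rep_z: "rep a b c p (monom_coeffs 0 (Suc 0) 0) = shift_z ?V"
    using cong_rel_rep[OF z, of "monom_coeffs 0 0 0"] by (simp add: rep_mult rep_one_eq shift_z_monom)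
  have on_y: "?V 0 0 n = 0" if "n > 0" for n
  proof -
    \<comment> \<open>The coefficient of \<open>z^(n+1)\<close> in \<open>p z\<close> isolates the
      term \<open>y^n\<close>, as only pure powers of \<open>y\<close> survive in
      \<open>v\<close>.\<close>
    have "rep a b c p (monom_coeffs 0 (Suc 0) 0) 0 (Suc n) 0 =
      (\<Sum>s\<in>Poly_Mapping.keys v. if s = (0, 0, n) then ?V 0 0 n * ((- c) ^ n * fact n) else 0)"
      unfolding cong_rel_rep[OF v] rep_pbw
    proof (intro sum.cong refl)
      fix s
      assume "s \<in> Poly_Mapping.keys v"
      moreover obtain l m k where s: "s = (l, m, k)"
        by (cases s) auto
      ultimately have "(l, m) = (0, 0)"
        using off_y[of l m k] by (metis in_keys_iff)
      then show "Poly_Mapping.lookup v s * rep a b c (pbw_monom s) (monom_coeffs 0 (Suc 0) 0) 0 (Suc n) 0 =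
        (if s = (0, 0, n) then ?V 0 0 n * ((- c) ^ n * fact n) else 0)"
        by (simp add: s rep_pbw_monom_z)
    qed
    also have "\<dots> = ?V 0 0 n * ((- c) ^ n * fact n)"
      by (simp add: in_keys_iff)
    \<comment> \<open>In \<open>z p\<close> the same coefficient is that of \<open>z^n\<close> in
      \<open>p\<close>, which is zero for \<open>n > 0\<close>; the factorial is nonzero in
      characteristic 0.\<close>
    finally have "?V 0 0 n * ((- c) ^ n * fact n) = ?V 0 n 0"
      by (simp add: rep_z)
    with off_y[of 0 n 0] that \<open>c \<noteq> 0\<close> show ?thesis
      by simp
  qed
  have "v = Poly_Mapping.single (0, 0, 0) (?V 0 0 0)"
  proof (rule poly_mapping_eqI)
    fix s :: "nat \<times> nat \<times> nat"
    obtain l m n where s: "s = (l, m, n)"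
      by (cases s) auto
    show "Poly_Mapping.lookup v s = Poly_Mapping.lookup (Poly_Mapping.single (0, 0, 0) (?V 0 0 0)) s"
      using off_y[of l m n] on_y[of n]
      by (cases "l = 0"; cases "m = 0") (auto simp: s lookup_single when_def)
  qed
  then have "pbw v = scalar (?V 0 0 0)"
    by (metis (no_types, lifting) mult.right_neutral pbw_monom_def pbw_single power_0 case_prod_conv)
  with v show ?thesis
    by auto
qed

section \<open>Passage from congruences to cosets\<close>

abbreviation coset :: "'k::field \<Rightarrow> 'k \<Rightarrow> 'k \<Rightarrow> 'k free_alg \<Rightarrow> 'k free_alg set" where
  "coset a b c p \<equiv> rel_ideal a b c +>\<^bsub>ring_of_type_algebra\<^esub> p"

lemma coset_eq_iff: "coset a b c p = coset a b c q \<longleftrightarrow> cong_rel a b c p q"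
proof
  have mem: "r \<in> coset a b c s \<longleftrightarrow> cong_rel a b c r s" for r s
    by (auto simp: a_r_coset_def' cong_rel_def intro: bexI[of _ "r - s"])
  {
    assume "coset a b c p = coset a b c q"
    then show "cong_rel a b c p q"
      using mem by (metis cong_rel_refl)
  }
  {
    assume "cong_rel a b c p q"
    then show "coset a b c p = coset a b c q"
      using mem by (blast intro: cong_rel_trans cong_rel_sym)
  }
qed

lemma carrier_A2: "carrier (A2 a b c) = range (coset a b c)"
  by (auto simp: A2_def FactRing_def A_RCOSETS_def')

lemma mult_A2: "coset a b c p \<otimes>\<^bsub>A2 a b c\<^esub> coset a b c q = coset a b c (p * q)"
  using ideal.rcoset_mult_add[OF ideal_rel_ideal, of p q a b c]
  by (simp add: A2_def FactRing_def)

lemma mem_center_A2: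
  "coset a b c p \<in> ring_center (A2 a b c) \<longleftrightarrow> (\<forall>q. cong_rel a b c (p * q) (q * p))"
  by (auto simp: ring_center_def carrier_A2 mult_A2 coset_eq_iff)

text \<open>Multiplying the equation by \<open>a\<close> gives \<open>i a^2 + j (- a c) = 0\<close>,
  where \<open>a^2\<close> and \<open>- a c\<close> are both positive; such a sum vanishes only for
  \<open>i = j = 0\<close>.\<close>

lemma ordered_subfield_eigenvalue:
  fixes a c :: "'k::field_char_0"
  assumes F: "ordered_subfield F lt" "a \<in> F" "c \<in> F" and neg: "lt (a * c) 0"
    and eq: "a * of_nat i = c * of_nat j"
  shows "i = 0 \<and> j = 0"
proof -
  have sr: "subring F ring_of_type_algebra"
    using F(1) by (auto simp: ordered_subfield_def intro: subfieldE(1))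
  interpret R: Ring.field "ring_of_type_algebra :: 'k ring"
    by (rule field_from_type_algebra)
  have zero: "0 \<in> F" and mult: "u * w \<in> F" and add: "u + w \<in> F" if "u \<in> F" "w \<in> F" for u w
    using subringE(2,6,7)[OF sr] that by auto
  have irrefl: "\<not> lt u u" if "u \<in> F" for u
    using F(1) that by (auto simp: ordered_subfield_def)
  have trans: "lt u w" if "lt u v" "lt v w" "u \<in> F" "v \<in> F" "w \<in> F" for u v w
    using F(1) that unfolding ordered_subfield_def by blast
  have total: "lt u v \<or> lt v u" if "u \<noteq> v" "u \<in> F" "v \<in> F" for u v
    using F(1) that unfolding ordered_subfield_def by blast
  have mono: "lt (u + w) (v + w)" if "lt u v" "u \<in> F" "v \<in> F" "w \<in> F" for u v w
    using F(1) that unfolding ordered_subfield_def by blast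
  have pos: "lt 0 (u * v)" if "lt 0 u" "lt 0 v" "u \<in> F" "v \<in> F" for u v
    using F(1) that unfolding ordered_subfield_def by blast
  have uminus: "- u \<in> F" if "u \<in> F" for u
  proof -
    have "\<ominus>\<^bsub>ring_of_type_algebra\<^esub> u = - u"
      by (rule R.minus_equality) simp_all
    then show ?thesis
      using subringE(5)[OF sr that] by simp
  qed
  have F0: "0 \<in> F"
    using zero F(2) by blast
  have a: "a \<noteq> 0" and c: "c \<noteq> 0"
    using neg irrefl[OF F0] by auto
  have sq: "lt 0 (a * a)"
    using total[OF a F(2) F0]
  proof
    assume "lt a 0"
    then have "lt 0 (- a)"
      using mono[of a 0 "- a"] F(2) F0 uminus by simp
    then show ?thesis
      using pos[of "- a" "- a"] F(2) uminus by simp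
  qed (use pos F(2) in blast)
  have neg': "lt 0 (- (a * c))"
    using mono[OF neg mult[OF F(2,3)] F0 uminus[OF mult[OF F(2,3)]]] by simp
  have nat_mem: "of_nat n * u \<in> F" if "u \<in> F" for n u
    using that by (induction n) (auto simp: F0 add distrib_right)
  have nat_pos: "n > 0 \<Longrightarrow> lt 0 (of_nat n * u)" if "lt 0 u" "u \<in> F" for n u
  proof (induction n)
    case (Suc n)
    show ?case
    proof (cases "n = 0")
      case False
      then have "lt 0 (of_nat n * u)"
        using Suc by simp
      then have "lt u (of_nat n * u + u)"
        using mono[of 0 "of_nat n * u" u] that nat_mem F0 by simp
      then show ?thesis
        using trans[of 0 u "of_nat n * u + u"] that nat_mem F0 add by (simp add: algebra_simps)
    qed (use that in simp)
  qed simp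
  have sum: "of_nat i * (a * a) + of_nat j * (- (a * c)) = 0"
    using arg_cong[OF eq, of "\<lambda>t. a * t"] by (simp add: algebra_simps)
  show ?thesis
  proof (rule ccontr)
    assume "\<not> (i = 0 \<and> j = 0)"
    \<comment> \<open>Both \<open>a\<close> and \<open>c\<close> are nonzero, so in characteristic 0
      one side vanishes exactly when the other does.\<close>
    moreover have "i = 0 \<longleftrightarrow> j = 0"
      using eq a c by auto
    ultimately have "i > 0" "j > 0"
      by auto
    let ?u = "of_nat i * (a * a)" and ?w = "of_nat j * (- (a * c))"
    have u: "lt 0 ?u" "?u \<in> F" and w: "lt 0 ?w" "?w \<in> F"
      using nat_pos[OF sq] nat_pos[OF neg'] nat_mem mult uminus F(2,3) \<open>i > 0\<close> \<open>j > 0\<close> by blast+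
    \<comment> \<open>The chain \<open>0 < ?w < ?u + ?w = 0\<close> contradicts
      irreflexivity.\<close>
    have "lt ?w (?u + ?w)"
      using mono[OF u(1) F0 u(2) w(2)] by simp
    then show False
      using trans[OF w(1)] w F0 irrefl sum by metis
  qed
qed

text \<open>The identification of the center with \<open>K\<close> is made through the map from
  \<open>K\<close> to the quotient: its range is the center, and it is injective.\<close>

theorem theorem3p11:
  fixes a b c :: "'k::field_char_0"
    and F :: "'k set" and lt :: "'k \<Rightarrow> 'k \<Rightarrow> bool"
  assumes "a \<noteq> 0" and "b \<noteq> 0" and "c \<noteq> 0"
    and "ordered_subfield F lt" and "a \<in> F" and "c \<in> F"
    and "lt (a * c) 0"
  shows "ring_center (A2 a b c) = range (A2_scalar a b c) \<and> inj (A2_scalar a b c)"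
proof
  show "ring_center (A2 a b c) = range (A2_scalar a b c)"
  proof
    show "range (A2_scalar a b c) \<subseteq> ring_center (A2 a b c)"
      by (auto simp: A2_scalar_def mem_center_A2 scalar_commute)
    show "ring_center (A2 a b c) \<subseteq> range (A2_scalar a b c)"
    proof
      fix u
      assume u: "u \<in> ring_center (A2 a b c)"
      then obtain p where p: "u = coset a b c p"
        by (auto simp: ring_center_def carrier_A2)
      have "\<exists>r. cong_rel a b c p (scalar r)"
        using u ordered_subfield_eigenvalue[OF assms(4-7)] \<open>c \<noteq> 0\<close>
        by (intro central_cong_scalar) (auto simp: p mem_center_A2)
      then show "u \<in> range (A2_scalar a b c)"
        by (auto simp: p A2_scalar_def coset_eq_iff)
    qed
  qed
  show "inj (A2_scalar a b c)"
  proof (rule injI)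
    fix r s
    assume "A2_scalar a b c r = A2_scalar a b c s"
    then have "cong_rel a b c (scalar r) (scalar s)"
      by (simp add: A2_scalar_def coset_eq_iff)
    \<comment> \<open>A scalar acts as multiplication by itself, so the constant family 1 returns
      \<open>r\<close> and \<open>s\<close>.\<close>
    from cong_rel_rep[OF this, of "\<lambda>i j k. 1"] show "r = s"
      by (simp add: fun_eq_iff)
  qed
qed

end
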